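(* Let $k,n,s$ be positive integers and let $x_1,\dots,x_n$ be independent variables. Then \[ \sum_{j=0}^{k}e_j(x_1,\ldots,x_n)\,h_{k-j}(x_1,\ldots,x_n)=\sum_{j=0}^{k}M^{(s)}_j(x_1,\ldots,x_n)\,E^{(s)}_{k-j}(x_1,\ldots,x_n). \]
   Context: $M_{m}^{(s)}(x_{1},\ldots,x_{n})=\sum x_{1}^{a_{1}}\cdots x_{n}^{a_{n}}$, the sum over all $n$-tuples of nonnegative integers with $a_1+\cdots+a_n=m$ and each $a_i\equiv 0$ or $1 \pmod{s+1}$. $E_m^{(s)}(x_1,\dots,x_n)=\sum x_1^{a_1}\cdots x_n^{a_n}$, the sum over all $n$-tuples of nonnegative integers with $a_1+\cdots+a_n=m$ and each $a_i\le s$. $h_j$ and $e_j$ are the complete homogeneous and elementary symmetric polynomials. *)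

theory Defs
  imports "HOL-Library.Poly_Mapping" "HOL-Library.FuncSet" "HOL-Number_Theory.Cong"
begin

text \<open>
  Polynomials over \<open>'a\<close> in the indeterminates \<open>x\<^sub>i\<close>, \<open>i :: nat\<close>, as finitely supported maps from
  exponent vectors to coefficients; multiplication is the convolution product of
  \<^theory>\<open>HOL-Library.Poly_Mapping\<close>. Polynomials in \<open>x\<^sub>1, \<dots>, x\<^sub>n\<close> are those involving only these
  indeterminates.
\<close>

type_synonym 'a mpoly = "(nat \<Rightarrow>\<^sub>0 nat) \<Rightarrow>\<^sub>0 'a"

definition X :: "nat \<Rightarrow> 'a::comm_ring_1 mpoly" where
  "X i = Poly_Mapping.single (Poly_Mapping.single i 1) 1"

text \<open>
  An \<open>n\<close>-tuple \<open>(a\<^sub>1, \<dots>, a\<^sub>n)\<close> is a function that is \<open>undefined\<close> outside \<open>{1..n}\<close>, so that each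
  tuple is represented exactly once.
\<close>

definition tuples :: "nat \<Rightarrow> nat \<Rightarrow> (nat \<Rightarrow> nat) set" where
  "tuples n m = {a \<in> {1..n} \<rightarrow>\<^sub>E UNIV. (\<Sum>i=1..n. a i) = m}"

lemma finite_tuples: "finite (tuples n m)"
proof (rule finite_subset)
  show "tuples n m \<subseteq> {1..n} \<rightarrow>\<^sub>E {..m}"
    unfolding tuples_def by (auto simp: PiE_iff extensional_def intro: member_le_sum)
  show "finite ({1..n} \<rightarrow>\<^sub>E {..m})"
    by (intro finite_PiE) auto
qed

definition monomial :: "nat \<Rightarrow> (nat \<Rightarrow> nat) \<Rightarrow> 'a::comm_ring_1 mpoly" where
  "monomial n a = (\<Prod>i=1..n. X i ^ a i)"

definition e_poly :: "nat \<Rightarrow> nat \<Rightarrow> 'a::comm_ring_1 mpoly" where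
  "e_poly n j = (\<Sum>I | I \<subseteq> {1..n} \<and> card I = j. \<Prod>i\<in>I. X i)"

definition h_poly :: "nat \<Rightarrow> nat \<Rightarrow> 'a::comm_ring_1 mpoly" where
  "h_poly n j = (\<Sum>a\<in>tuples n j. monomial n a)"

definition M_poly :: "nat \<Rightarrow> nat \<Rightarrow> nat \<Rightarrow> 'a::comm_ring_1 mpoly" where
  "M_poly s n m =
    (\<Sum>a | a \<in> tuples n m \<and> (\<forall>i\<in>{1..n}. [a i = 0] (mod (s + 1)) \<or> [a i = 1] (mod (s + 1))).
       monomial n a)"

definition E_poly :: "nat \<Rightarrow> nat \<Rightarrow> nat \<Rightarrow> 'a::comm_ring_1 mpoly" where
  "E_poly s n m = (\<Sum>a | a \<in> tuples n m \<and> (\<forall>i\<in>{1..n}. a i \<le> s). monomial n a)"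

end

theory Submission
  imports Defs "HOL-Computational_Algebra.Formal_Power_Series"
begin

text \<open>
  Both sides are the coefficient of \<open>t\<^sup>k\<close> in \<open>\<Prod>\<^sub>i (1 + x\<^sub>i t) / (1 - x\<^sub>i t)\<close>. Each of the four
  families has a generating function that is a product over \<open>i\<close> of series
  \<open>\<Sum>\<^sub>a\<^sub>\<in>\<^sub>S x\<^sub>i\<^sup>a t\<^sup>a\<close> with a set \<open>S\<close> of admissible exponents. With \<open>G = \<Sum>\<^sub>q (x t)\<^bsup>q (s + 1)\<^esup>\<close>, the factor
  for \<open>M\<close> is \<open>(1 + x t) G\<close>, and multiplying \<open>G\<close> by the factor \<open>1 + x t + \<dots> + (x t)\<^sup>s\<close> for \<open>E\<close> gives
  the factor \<open>1 / (1 - x t)\<close> for \<open>h\<close>, since every exponent is uniquely \<open>q (s + 1) + r\<close> with \<open>r \<le> s\<close>.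
\<close>

definition power_fps :: "nat set \<Rightarrow> 'a::comm_ring_1 \<Rightarrow> 'a fps" where
  "power_fps S x = Abs_fps (\<lambda>a. if a \<in> S then x ^ a else 0)"

lemma power_fps_nth [simp]: "fps_nth (power_fps S x) a = (if a \<in> S then x ^ a else 0)"
  by (simp add: power_fps_def)

lemma fps_const_prod: "(\<Prod>i\<in>I. fps_const (f i)) = fps_const (\<Prod>i\<in>I. f i :: 'a::comm_ring_1)"
  by (induction I rule: infinite_finite_induct) auto

text \<open>The product rule \<open>fps_prod_nth'\<close> indexes coefficients by multisets of
  factor indices; the multiplicity of \<open>i\<close> is the exponent taken from factor
  \<open>i\<close>. The \<open>restrict\<close> supplies the value \<open>undefined\<close> outside
  \<open>{1..n}\<close> that \<open>tuples\<close> demands.\<close>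

lemma bij_betw_tuples_multisets:
  "bij_betw (\<lambda>A. restrict (count A) {1..n}) (multisets_of_size {1..n} m) (tuples n m)"
proof (rule bij_betw_byWitness[where f' = "\<lambda>a. \<Sum>i=1..n. replicate_mset (a i) i"])
  have count: "count (\<Sum>i=1..n. replicate_mset (a i) i) j = (if j \<in> {1..n} then a j else 0)"
    for a :: "nat \<Rightarrow> nat" and j
    by (auto simp: count_sum)
  show "\<forall>A\<in>multisets_of_size {1..n} m.
      (\<Sum>i=1..n. replicate_mset (restrict (count A) {1..n} i) i) = A"
  proof (intro ballI multiset_eqI)
    fix A j assume "A \<in> multisets_of_size {1..n} m"
    then show "count (\<Sum>i=1..n. replicate_mset (restrict (count A) {1..n} i) i) j = count A j"
      unfolding count by (auto simp: multisets_of_size_def not_in_iff)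
  qed
  show "\<forall>a\<in>tuples n m. restrict (count (\<Sum>i=1..n. replicate_mset (a i) i)) {1..n} = a"
  proof (intro ballI ext)
    fix a j assume "a \<in> tuples n m"
    then show "restrict (count (\<Sum>i=1..n. replicate_mset (a i) i)) {1..n} j = a j"
      unfolding restrict_def count by (auto simp: tuples_def PiE_def extensional_def)
  qed
  show "(\<lambda>A. restrict (count A) {1..n}) ` multisets_of_size {1..n} m \<subseteq> tuples n m"
    by (auto simp: multisets_of_size_def tuples_def size_multiset_overloaded_eq
        intro!: sum.mono_neutral_right simp: not_in_iff)
  show "(\<lambda>a. \<Sum>i=1..n. replicate_mset (a i) i) ` tuples n m \<subseteq> multisets_of_size {1..n} m"
  proof (intro image_subsetI)
    fix a assume "a \<in> tuples n m"
    moreover have "set_mset (\<Sum>i=1..n. replicate_mset (a i) i) \<subseteq> {1..n}"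
      using count[of a] by (metis (no_types, lifting) not_in_iff subsetI)
    ultimately show "(\<Sum>i=1..n. replicate_mset (a i) i) \<in> multisets_of_size {1..n} m"
      by (simp add: multisets_of_size_def tuples_def)
  qed
qed

lemma fps_nth_prod_tuples:
  "fps_nth (\<Prod>i=1..n. f i) m = (\<Sum>a\<in>tuples n m. \<Prod>i=1..n. fps_nth (f i) (a i))"
proof -
  have "fps_nth (\<Prod>i=1..n. f i) m =
      (\<Sum>A\<in>multisets_of_size {1..n} m. \<Prod>i=1..n. fps_nth (f i) (restrict (count A) {1..n} i))"
    by (simp add: fps_prod_nth')
  also have "\<dots> = (\<Sum>a\<in>tuples n m. \<Prod>i=1..n. fps_nth (f i) (a i))"
    by (rule sum.reindex_bij_betw[OF bij_betw_tuples_multisets])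
  finally show ?thesis .
qed

lemma fps_nth_prod_power_fps:
  "fps_nth (\<Prod>i=1..n. power_fps S (X i)) m =
    (\<Sum>a | a \<in> tuples n m \<and> (\<forall>i\<in>{1..n}. a i \<in> S). monomial n a)"
proof -
  have "fps_nth (\<Prod>i=1..n. power_fps S (X i)) m =
      (\<Sum>a\<in>tuples n m. \<Prod>i=1..n. if a i \<in> S then X i ^ a i else 0)"
    by (simp only: fps_nth_prod_tuples power_fps_nth)
  \<comment> \<open>A single exponent outside \<open>S\<close> annihilates the whole
    product.\<close>
  also have "\<dots> = (\<Sum>a\<in>tuples n m. if \<forall>i\<in>{1..n}. a i \<in> S then monomial n a else 0)"
    by (intro sum.cong refl) (auto simp: monomial_def intro!: prod_zero)
  also have "\<dots> = (\<Sum>a | a \<in> tuples n m \<and> (\<forall>i\<in>{1..n}. a i \<in> S). monomial n a)"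
    by (simp add: sum.inter_filter finite_tuples)
  finally show ?thesis .
qed

lemma h_poly_fps: "h_poly n m = fps_nth (\<Prod>i=1..n. power_fps UNIV (X i)) m"
  by (simp only: fps_nth_prod_power_fps h_poly_def UNIV_I) simp

lemma E_poly_fps: "E_poly s n m = fps_nth (\<Prod>i=1..n. power_fps {..s} (X i)) m"
  by (simp only: fps_nth_prod_power_fps E_poly_def atMost_iff)

lemma M_poly_fps:
  "M_poly s n m = fps_nth
    (\<Prod>i=1..n. power_fps {a. [a = 0] (mod (s + 1)) \<or> [a = 1] (mod (s + 1))} (X i)) m"
  by (simp only: fps_nth_prod_power_fps M_poly_def mem_Collect_eq)

lemma e_poly_fps: "e_poly n m = fps_nth (\<Prod>i=1..n. fps_const (X i) * fps_X + 1) m"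
proof -
  \<comment> \<open>Expanding, \<open>I\<close> is the set of factors that contribute their linear
    term; the others contribute 1, so the degree is \<open>card I\<close>.\<close>
  have "(\<Prod>i=1..n. fps_const (X i) * fps_X + 1) =
      (\<Sum>I\<in>Pow {1..n}. fps_const (\<Prod>i\<in>I. X i :: 'a mpoly) * fps_X ^ card I)"
    by (simp add: prod_add prod.distrib fps_const_prod)
  also have "fps_nth \<dots> m = (\<Sum>I\<in>Pow {1..n}. if card I = m then \<Prod>i\<in>I. X i else 0)"
    by (auto simp: fps_sum_nth intro!: sum.cong)
  also have "\<dots> = e_poly n m"
    by (simp add: sum.inter_filter[symmetric] e_poly_def)
  finally show ?thesis ..
qed

text \<open>Division with remainder by \<open>s + 1\<close> leaves exactly one nonzero term in each
  convolution sum.\<close>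

lemma power_fps_dvd_mult_atMost:
  "power_fps {a. s + 1 dvd a} x * power_fps {..s} x = power_fps UNIV x"
proof (rule fps_ext)
  fix k
  \<comment> \<open>The right-hand side is the largest multiple of \<open>s + 1\<close> up to
    \<open>k\<close>. The bound \<open>a \<le> k\<close> keeps the truncated subtraction
    \<open>k - a\<close> honest.\<close>
  have dvd_iff: "s + 1 dvd a \<and> k - a \<le> s \<longleftrightarrow> a = k - k mod (s + 1)" if "a \<le> k" for a
  proof
    assume *: "s + 1 dvd a \<and> k - a \<le> s"
    then obtain q where "a = (s + 1) * q" by blast
    with * that have "k mod (s + 1) = k - a"
      by (metis le_add_diff_inverse less_Suc_eq_le mod_less mod_mult_self4 Suc_eq_plus1
          mult.commute add.commute mod_mult_self2)
    with that show "a = k - k mod (s + 1)" by simp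
  next
    assume "a = k - k mod (s + 1)"
    then show "s + 1 dvd a \<and> k - a \<le> s"
      by (metis Suc_eq_plus1 diff_diff_cancel dvd_minus_mod less_Suc_eq_le mod_less_divisor
          mod_less_eq_dividend zero_less_Suc)
  qed
  have "fps_nth (power_fps {a. s + 1 dvd a} x * power_fps {..s} x) k =
      (\<Sum>a=0..k. if a = k - k mod (s + 1) then x ^ k else 0)"
    unfolding fps_mult_nth
    by (intro sum.cong refl) (use dvd_iff in \<open>force simp flip: power_add\<close>)
  also have "\<dots> = x ^ k"
    by simp
  finally show "fps_nth (power_fps {a. s + 1 dvd a} x * power_fps {..s} x) k =
      fps_nth (power_fps UNIV x) k"
    by simp
qed

text \<open>Exponents congruent to 1 are the multiples of \<open>s + 1\<close> shifted by one, which
  is multiplication by \<open>x t\<close>. As \<open>s \<ge> 1\<close>, the residues 0 and 1 differ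
  and no exponent is counted twice.\<close>

lemma power_fps_cong_0_1:
  assumes "s \<ge> 1"
  shows "power_fps {a. [a = 0] (mod (s + 1)) \<or> [a = 1] (mod (s + 1))} x =
    (fps_const x * fps_X + 1) * power_fps {a. s + 1 dvd a} x"
proof (rule fps_ext)
  fix k
  show "fps_nth (power_fps {a. [a = 0] (mod (s + 1)) \<or> [a = 1] (mod (s + 1))} x) k =
    fps_nth ((fps_const x * fps_X + 1) * power_fps {a. s + 1 dvd a} x) k"
  proof (cases k)
    case 0
    then show ?thesis by (simp add: algebra_simps)
  next
    case (Suc j)
    have "[Suc j = 0] (mod (s + 1)) \<longleftrightarrow> s + 1 dvd Suc j"
      by (rule cong_0_iff)
    moreover have "[Suc j = 1] (mod (s + 1)) \<longleftrightarrow> s + 1 dvd j"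
      using cong_add_rcancel_nat[of j 1 0 "s + 1"] by (simp add: cong_0_iff)
    \<comment> \<open>Otherwise \<open>s + 1\<close> would divide 1, forcing
      \<open>s = 0\<close>.\<close>
    moreover have "\<not> (s + 1 dvd Suc j \<and> s + 1 dvd j)"
      using assms by (metis Suc_eq_plus1 dvd_add_right_iff nat_dvd_1_iff_1 add_is_0
          add_eq_self_zero add_cancel_left_left not_one_le_zero)
    ultimately show ?thesis
      using Suc by (auto simp: distrib_right mult.assoc)
  qed
qed

theorem theorem5p4:
  fixes k n s :: nat
  assumes "k \<ge> 1" and "n \<ge> 1" and "s \<ge> 1"
  shows "(\<Sum>j=0..k. e_poly n j * h_poly n (k - j)) =
         (\<Sum>j=0..k. M_poly s n j * E_poly s n (k - j) :: 'a::comm_ring_1 mpoly)"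
proof -
  let ?M = "{a. [a = 0] (mod (s + 1)) \<or> [a = 1] (mod (s + 1))}"
  have "(\<Prod>i=1..n. fps_const (X i) * fps_X + 1) * (\<Prod>i=1..n. power_fps UNIV (X i)) =
      (\<Prod>i=1..n. power_fps ?M (X i)) * (\<Prod>i=1..n. power_fps {..s} (X i :: 'a mpoly))"
    \<comment> \<open>Merging the products reduces the claim to single factors; reassociating puts
      the series over multiples of \<open>s + 1\<close> next to the factor for
      \<open>E_poly\<close>.\<close>
    unfolding power_fps_cong_0_1[OF assms(3)] prod.distrib[symmetric] mult.assoc
      power_fps_dvd_mult_atMost ..
  then show ?thesis
    unfolding e_poly_fps h_poly_fps M_poly_fps E_poly_fps fps_mult_nth[symmetric] by (rule arg_cong)
qed

end
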